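(* Let $p,q\in\mathbb{C}^*$ with $p\neq q$. Let $A = \mathbb{C}[t,t^{-1}]$, let $\tau,\sigma$ be the $\mathbb{C}$-algebra endomorphisms of $A$ with $\tau(t)=pt$, $\sigma(t)=qt$, and let $\partial = \dfrac{\tau - \sigma}{t(p-q)}$, a $(\tau,\sigma)$-derivation of $A$. Let $[\cdot,\cdot]_{p,q}$ denote the bracket on $A\cdot\partial$ given by $$[a \cdot \partial,b \cdot \partial]_{p,q} = \big(\sigma\tau^{-1}(a)\, \partial\tau^{-1}(b) - \sigma\tau^{-1}(b)\, \partial\tau^{-1}(a)\big) \cdot \partial \qquad (a,b\in A).$$ Then the linear subspace $S$ spanned by $e := \partial$, $f := - t^2 \cdot \partial$, $h := - 2t \cdot \partial$ is a Hom-Lie algebra, with brackets and twist $\alpha_{p,q}$ given by $$[h,e]_{p,q} = 2p^{-1} e, \qquad [h,f]_{p,q} = -2qp^{-2} f, \qquad [e,f]_{p,q} = \frac{p+q}{2p^2}\, h,$$ $$\alpha_{p,q}(e) = (1+qp^{-1})e, \qquad \alpha_{p,q}(f) = qp^{-1}(1+qp^{-1}) f, \qquad \alpha_{p,q}(h) = 2qp^{-1} h.$$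
   Context: A $(\tau,\sigma)$-derivation of $A$ is a $\mathbb{C}$-linear map $D : A \to A$ with $D(ab)=D(a)\tau(b)+\sigma(a)D(b)$ for all $a,b\in A$. For $a\in A$, $a\cdot \partial$ is the map $x\mapsto a\,\partial(x)$, and $A\cdot\partial=\{a\cdot\partial : a\in A\}$. Explicitly, $\partial(t^n)=\frac{p^n-q^n}{p-q}t^{n-1}$. A Hom-Lie algebra over $\mathbb{C}$ is a triple $(L,[\cdot,\cdot],\alpha)$ with $L$ a vector space, $[\cdot,\cdot]$ a bilinear skew-symmetric bracket on $L$ and $\alpha:L\to L$ a linear map (the twist) such that $[\alpha(x),[y,z]]+[\alpha(y),[z,x]]+[\alpha(z),[x,y]]=0$ for all $x,y,z\in L$. *)

theory Defs
  imports Complex_Main "HOL-Library.Poly_Mapping" "HOL-Library.Function_Algebras"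
begin

text \<open>
  The Laurent polynomial ring \<open>\<complex>[t, t\<^sup>-\<^sup>1]\<close> is the group algebra of the additive group of integers over
  the complex numbers: finitely supported functions from \<open>int\<close> to \<open>complex\<close>, with the convolution
  product of \<^theory>\<open>HOL-Library.Poly_Mapping\<close>.
\<close>

type_synonym laurent = "int \<Rightarrow>\<^sub>0 complex"

definition tpow :: "int \<Rightarrow> laurent"
  where "tpow n = Poly_Mapping.single n 1"

abbreviation tvar :: laurent
  where "tvar \<equiv> tpow 1"

definition lscale :: "complex \<Rightarrow> laurent \<Rightarrow> laurent"
  where "lscale c a = Poly_Mapping.single 0 c * a"

definition mscale :: "complex \<Rightarrow> (laurent \<Rightarrow> laurent) \<Rightarrow> (laurent \<Rightarrow> laurent)"
  where "mscale c X = (\<lambda>x. lscale c (X x))"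

interpretation laurent: vector_space lscale
proof
  show "lscale a (x + y) = lscale a x + lscale a y" for a x y
    by (simp add: lscale_def distrib_left)
  show "lscale (a + b) x = lscale a x + lscale b x" for a b x
    by (simp add: lscale_def distrib_right single_add)
  show "lscale a (lscale b x) = lscale (a * b) x" for a b x
    by (simp add: lscale_def mult_single flip: mult.assoc)
  show "lscale 1 x = x" for x
    by (simp add: lscale_def)
qed

text \<open>The addition on the function type is the pointwise one from
  \<^theory>\<open>HOL-Library.Function_Algebras\<close>.\<close>

interpretation laurent_maps: vector_space mscale
  by unfold_locales
    (simp_all add: mscale_def fun_eq_iff laurent.scale_right_distrib laurent.scale_left_distrib)

definition laurent_endomorphism :: "(laurent \<Rightarrow> laurent) \<Rightarrow> bool"
  where "laurent_endomorphism \<phi> \<longleftrightarrow>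
    Vector_Spaces.linear lscale lscale \<phi> \<and> \<phi> 1 = 1 \<and> (\<forall>a b. \<phi> (a * b) = \<phi> a * \<phi> b)"

definition twisted_derivation ::
    "(laurent \<Rightarrow> laurent) \<Rightarrow> (laurent \<Rightarrow> laurent) \<Rightarrow> (laurent \<Rightarrow> laurent) \<Rightarrow> bool"
  where "twisted_derivation \<tau> \<sigma> D \<longleftrightarrow>
    Vector_Spaces.linear lscale lscale D \<and> (\<forall>a b. D (a * b) = D a * \<tau> b + \<sigma> a * D b)"

text \<open>\<open>(\<tau> - \<sigma>) / (t (p - q))\<close>; here \<open>tpow (-1)\<close> is the inverse of \<open>t\<close>, see \<open>tvar_inverse\<close> below.\<close>

definition pq_derivation ::
    "complex \<Rightarrow> complex \<Rightarrow> (laurent \<Rightarrow> laurent) \<Rightarrow> (laurent \<Rightarrow> laurent) \<Rightarrow> (laurent \<Rightarrow> laurent)"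
  where "pq_derivation p q \<tau> \<sigma> = (\<lambda>a. lscale (1 / (p - q)) (tpow (-1) * (\<tau> a - \<sigma> a)))"

definition lmult :: "laurent \<Rightarrow> (laurent \<Rightarrow> laurent) \<Rightarrow> (laurent \<Rightarrow> laurent)"  (infixr "\<cdot>" 72)
  where "a \<cdot> D = (\<lambda>x. a * D x)"

text \<open>The triple \<open>(L, br, \<alpha>)\<close> is given on a carrier \<open>L\<close>, a subspace of an ambient complex vector space
  with scalar multiplication \<open>s\<close>; the values of \<open>br\<close> and \<open>\<alpha>\<close> outside \<open>L\<close> are irrelevant.\<close>

definition hom_lie_algebra ::
    "(complex \<Rightarrow> 'v \<Rightarrow> 'v) \<Rightarrow> 'v set \<Rightarrow> ('v \<Rightarrow> 'v \<Rightarrow> 'v) \<Rightarrow> ('v \<Rightarrow> 'v::ab_group_add) \<Rightarrow> bool"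
  where "hom_lie_algebra s L br \<alpha> \<longleftrightarrow>
    vector_space s \<and> module.subspace s L \<and>
    (\<forall>x\<in>L. \<forall>y\<in>L. br x y \<in> L) \<and>
    (\<forall>x\<in>L. \<forall>y\<in>L. \<forall>z\<in>L. br (x + y) z = br x z + br y z) \<and>
    (\<forall>x\<in>L. \<forall>y\<in>L. \<forall>z\<in>L. br x (y + z) = br x y + br x z) \<and>
    (\<forall>c. \<forall>x\<in>L. \<forall>y\<in>L. br (s c x) y = s c (br x y)) \<and>
    (\<forall>c. \<forall>x\<in>L. \<forall>y\<in>L. br x (s c y) = s c (br x y)) \<and>
    (\<forall>x\<in>L. \<forall>y\<in>L. br x y = - br y x) \<and>
    (\<forall>x\<in>L. \<alpha> x \<in> L) \<and>
    (\<forall>x\<in>L. \<forall>y\<in>L. \<alpha> (x + y) = \<alpha> x + \<alpha> y) \<and>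
    (\<forall>c. \<forall>x\<in>L. \<alpha> (s c x) = s c (\<alpha> x)) \<and>
    (\<forall>x\<in>L. \<forall>y\<in>L. \<forall>z\<in>L.
      br (\<alpha> x) (br y z) + br (\<alpha> y) (br z x) + br (\<alpha> z) (br x y) = 0)"

lemma tpow_0: "tpow 0 = 1"
  by (simp add: tpow_def)

lemma tpow_add: "tpow (m + n) = tpow m * tpow n"
  by (simp add: tpow_def mult_single)

lemma tvar_inverse: "tvar * tpow (-1) = 1"
  by (simp flip: tpow_add add: tpow_0)

lemma lscale_mult_left: "lscale c a * b = lscale c (a * b)"
  by (simp add: lscale_def mult.assoc)

lemma lscale_mult_right: "a * lscale c b = lscale c (a * b)"
  by (simp add: lscale_def mult.left_commute)

lemma lscale_tpow: "lscale c (tpow n) = Poly_Mapping.single n c"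
  by (simp add: lscale_def tpow_def mult_single)

lemma laurent_induct [case_names zero add]:
  fixes a :: laurent
  assumes "P 0" and "\<And>n c a. P a \<Longrightarrow> P (lscale c (tpow n) + a)"
  shows "P a"
proof (induction a rule: update_induct)
  case const
  show ?case by (fact assms(1))
next
  case (update f a b)
  have "Poly_Mapping.update a b f = lscale b (tpow a) + f"
    using update(1)
    by (intro poly_mapping_eqI)
      (auto simp: lookup_update lscale_tpow lookup_add lookup_single in_keys_iff when_def)
  then show ?case using assms(2) update by simp
qed

lemma linear_eqI:
  assumes "Vector_Spaces.linear lscale lscale \<phi>" "Vector_Spaces.linear lscale lscale \<psi>"
    and "\<And>n. \<phi> (tpow n) = \<psi> (tpow n)"
  shows "\<phi> = \<psi>"
proof
  interpret \<phi>: Vector_Spaces.linear lscale lscale \<phi> by fact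
  interpret \<psi>: Vector_Spaces.linear lscale lscale \<psi> by fact
  show "\<phi> a = \<psi> a" for a
    by (induction a rule: laurent_induct)
      (simp_all add: \<phi>.zero \<psi>.zero \<phi>.add \<psi>.add \<phi>.scale \<psi>.scale assms(3))
qed

text \<open>For each nonzero \<open>p\<close> there is exactly one algebra endomorphism with \<open>t \<mapsto> p t\<close>.\<close>

lemma laurent_endomorphism_tpow:
  assumes "laurent_endomorphism \<phi>" "\<phi> tvar = lscale p tvar" "p \<noteq> 0"
  shows "\<phi> (tpow n) = lscale (p powi n) (tpow n)"
proof -
  interpret Vector_Spaces.linear lscale lscale \<phi>
    using assms(1) by (simp add: laurent_endomorphism_def)
  have one: "\<phi> 1 = 1" and mult: "\<And>a b. \<phi> (a * b) = \<phi> a * \<phi> b"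
    using assms(1) by (simp_all add: laurent_endomorphism_def)
  have nonneg: "\<phi> (tpow (int k)) = lscale (p ^ k) (tpow (int k))" for k
  proof (induction k)
    case 0
    show ?case by (simp add: tpow_0 one)
  next
    case (Suc k)
    have "\<phi> (tpow (int (Suc k))) = \<phi> tvar * \<phi> (tpow (int k))"
      by (simp add: mult tpow_add)
    then show ?case
      by (simp add: Suc assms(2) lscale_mult_left lscale_mult_right tpow_add)
  qed
  show ?thesis
  proof (cases "n \<ge> 0")
    case True
    then show ?thesis using nonneg[of "nat n"] by (simp add: power_int_def)
  next
    case False
    define k where "k = nat (-n)"
    have n: "n = - int k" using False by (simp add: k_def)
    have inv: "tpow (int k) * tpow n = 1" by (simp add: n tpow_0 flip: tpow_add)
    have "lscale (p ^ k) (tpow (int k)) * \<phi> (tpow n) = 1"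
      using nonneg[of k] mult[of "tpow (int k)" "tpow n"] by (simp add: inv one)
    then have "lscale (p powi n) (tpow n) * (lscale (p ^ k) (tpow (int k)) * \<phi> (tpow n))
        = lscale (p powi n) (tpow n)"
      by simp
    moreover have "lscale (p powi n) (tpow n) * (lscale (p ^ k) (tpow (int k)) * x)
        = (tpow (int k) * tpow n) * x" for x
      using \<open>p \<noteq> 0\<close>
      by (simp add: lscale_mult_left lscale_mult_right mult_ac n power_int_minus)
    ultimately show ?thesis by (simp add: inv)
  qed
qed

lemma laurent_endomorphism_unique:
  assumes "laurent_endomorphism \<phi>" "\<phi> tvar = lscale p tvar"
    and "laurent_endomorphism \<psi>" "\<psi> tvar = lscale p tvar" "p \<noteq> 0"
  shows "\<phi> = \<psi>"
proof (rule linear_eqI)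
  show "Vector_Spaces.linear lscale lscale \<phi>" "Vector_Spaces.linear lscale lscale \<psi>"
    using assms by (simp_all add: laurent_endomorphism_def)
  show "\<phi> (tpow n) = \<psi> (tpow n)" for n
    using laurent_endomorphism_tpow[OF assms(1,2,5)] laurent_endomorphism_tpow[OF assms(3,4,5)]
    by simp
qed

lemma laurent_endomorphism_exists:
  assumes "p \<noteq> 0"
  shows "\<exists>\<phi>. laurent_endomorphism \<phi> \<and> \<phi> tvar = lscale p tvar"
proof -
  define \<phi> :: "laurent \<Rightarrow> laurent" where "\<phi> a = Poly_Mapping.mapp (\<lambda>n c. p powi n * c) a" for a
  have lookup: "Poly_Mapping.lookup (\<phi> a) n = p powi n * Poly_Mapping.lookup a n" for a n
    by (cases "n \<in> Poly_Mapping.keys a") (simp_all add: \<phi>_def lookup_mapp in_keys_iff)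
  have lookup_scale: "Poly_Mapping.lookup (lscale c a) n = c * Poly_Mapping.lookup a n" for c a n
    by (simp add: lscale_def map.rep_eq when_def flip: mult_map_scale_conv_mult)
  have add: "\<phi> (a + b) = \<phi> a + \<phi> b" for a b
    by (rule poly_mapping_eqI) (simp add: lookup lookup_add distrib_left)
  have scale: "\<phi> (lscale c a) = lscale c (\<phi> a)" for c a
    by (rule poly_mapping_eqI) (simp add: lookup lookup_scale)
  have zero: "\<phi> 0 = 0"
    by (rule poly_mapping_eqI) (simp add: lookup)
  have tpow: "\<phi> (tpow n) = lscale (p powi n) (tpow n)" for n
    by (rule poly_mapping_eqI) (simp add: lookup lookup_scale tpow_def lookup_single when_def)
  have tpow_mult: "\<phi> (tpow m * tpow n) = \<phi> (tpow m) * \<phi> (tpow n)" for m n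
    using \<open>p \<noteq> 0\<close>
    by (simp add: tpow lscale_mult_left lscale_mult_right power_int_add mult.commute
        flip: tpow_add)
  have tpow_mult': "\<phi> (tpow m * b) = \<phi> (tpow m) * \<phi> b" for m b
    by (induction b rule: laurent_induct)
      (simp_all add: zero add scale tpow_mult distrib_left lscale_mult_right)
  have mult: "\<phi> (a * b) = \<phi> a * \<phi> b" for a b
    by (induction a rule: laurent_induct)
      (simp_all add: zero add scale tpow_mult' distrib_right lscale_mult_left)
  have "Vector_Spaces.linear lscale lscale \<phi>"
    by unfold_locales (simp_all add: add scale)
  moreover have "\<phi> 1 = 1" using tpow[of 0] by (simp add: tpow_0)
  ultimately have "laurent_endomorphism \<phi>"
    using mult by (simp add: laurent_endomorphism_def)
  moreover have "\<phi> tvar = lscale p tvar" using tpow[of 1] by simp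
  ultimately show ?thesis by blast
qed

lemma pq_derivation_tpow:
  assumes "laurent_endomorphism \<tau>" "\<tau> tvar = lscale p tvar" "p \<noteq> 0"
    and "laurent_endomorphism \<sigma>" "\<sigma> tvar = lscale q tvar" "q \<noteq> 0"
  shows "pq_derivation p q \<tau> \<sigma> (tpow n) = lscale ((p powi n - q powi n) / (p - q)) (tpow (n - 1))"
  unfolding pq_derivation_def laurent_endomorphism_tpow[OF assms(1-3)]
    laurent_endomorphism_tpow[OF assms(4-6)]
  by (simp add: lscale_mult_right flip: laurent.scale_left_diff_distrib tpow_add)

lemma twisted_derivation_pq_derivation:
  assumes "laurent_endomorphism \<tau>" "laurent_endomorphism \<sigma>"
  shows "twisted_derivation \<tau> \<sigma> (pq_derivation p q \<tau> \<sigma>)"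
proof -
  interpret \<tau>: Vector_Spaces.linear lscale lscale \<tau>
    using assms(1) by (simp add: laurent_endomorphism_def)
  interpret \<sigma>: Vector_Spaces.linear lscale lscale \<sigma>
    using assms(2) by (simp add: laurent_endomorphism_def)
  have mult: "\<tau> (a * b) = \<tau> a * \<tau> b" "\<sigma> (a * b) = \<sigma> a * \<sigma> b" for a b
    using assms by (simp_all add: laurent_endomorphism_def)
  have scale: "pq_derivation p q \<tau> \<sigma> (lscale c a) = lscale c (pq_derivation p q \<tau> \<sigma> a)" for c a
  proof -
    have "\<tau> (lscale c a) - \<sigma> (lscale c a) = lscale c (\<tau> a - \<sigma> a)"
      by (simp add: \<tau>.scale \<sigma>.scale laurent.scale_right_diff_distrib)
    then show ?thesis
      by (simp only: pq_derivation_def) (simp add: lscale_mult_right mult.commute)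
  qed
  have "Vector_Spaces.linear lscale lscale (pq_derivation p q \<tau> \<sigma>)"
    by unfold_locales
      (use scale in \<open>simp_all add: pq_derivation_def lscale_def \<tau>.add \<sigma>.add algebra_simps\<close>)
  then show ?thesis
    by (simp add: twisted_derivation_def pq_derivation_def mult lscale_def algebra_simps)
qed

text \<open>\<open>a \<cdot> \<partial>\<close> determines \<open>a\<close>, so a bracket on \<open>A \<cdot> \<partial>\<close> may be prescribed in terms of the coefficients.\<close>

lemma inj_lmult_pq_derivation:
  assumes "laurent_endomorphism \<tau>" "\<tau> tvar = lscale p tvar"
    and "laurent_endomorphism \<sigma>" "\<sigma> tvar = lscale q tvar" "p \<noteq> q"
  shows "inj (\<lambda>a. a \<cdot> pq_derivation p q \<tau> \<sigma>)"
proof (rule injI)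
  fix a b assume eq: "a \<cdot> pq_derivation p q \<tau> \<sigma> = b \<cdot> pq_derivation p q \<tau> \<sigma>"
  have "pq_derivation p q \<tau> \<sigma> tvar = 1"
    using assms(5)
    unfolding pq_derivation_def assms(2,4)
    by (simp add: lscale_mult_right tpow_0 flip: laurent.scale_left_diff_distrib tpow_add)
  then show "a = b"
    using fun_cong[OF eq, of tvar] by (simp add: lmult_def)
qed

lemma pq_bracket_exists:
  assumes "laurent_endomorphism \<tau>" "\<tau> tvar = lscale p tvar"
    and "laurent_endomorphism \<sigma>" "\<sigma> tvar = lscale q tvar" "p \<noteq> q"
    and "D = pq_derivation p q \<tau> \<sigma>"
  shows "\<exists>br. \<forall>a b. br (a \<cdot> D) (b \<cdot> D) =
    (\<sigma> (inv \<tau> a) * D (inv \<tau> b) - \<sigma> (inv \<tau> b) * D (inv \<tau> a)) \<cdot> D"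
proof -
  define cf where "cf = inv (\<lambda>a. a \<cdot> D)"
  have "cf (a \<cdot> D) = a" for a
    using inv_f_f[OF inj_lmult_pq_derivation[OF assms(1-5)], of a] by (simp add: cf_def assms(6))
  then show ?thesis
    by (intro exI[of _ "\<lambda>X Y. (\<sigma> (inv \<tau> (cf X)) * D (inv \<tau> (cf Y)) -
      \<sigma> (inv \<tau> (cf Y)) * D (inv \<tau> (cf X))) \<cdot> D"]) simp
qed

end

theory Submission
  imports Defs
begin

text \<open>
  Since \<open>\<partial>(t) = 1\<close>, evaluation at \<open>t\<close> recovers \<open>a\<close> from \<open>a \<cdot> \<partial>\<close>, and the twist becomes a globally
  defined map that rescales the coefficients of \<open>1\<close>, \<open>t\<close> and \<open>t\<^sup>2\<close>. In the coordinates
  \<open>x e + y f + z h\<close> the bracket is an explicit bilinear map (the \<open>t\<^sup>3\<close> terms cancel), and the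
  Hom-Jacobi identity is a polynomial identity in \<open>q / p\<close>, \<open>1 / (2 p)\<close> and nine coordinates.
\<close>

text \<open>The coefficient \<open>a\<close> for which \<open>a \<cdot> D\<close> is
  \<open>x e + y f + z h\<close>; the sign at \<open>tpow 2\<close> and the factor -2 at
  \<open>tpow 1\<close> come from the normalisation of \<open>f\<close> and
  \<open>h\<close>.\<close>

definition quad :: "complex \<Rightarrow> complex \<Rightarrow> complex \<Rightarrow> laurent"
  where "quad x y z = lscale x (tpow 0) + lscale (- y) (tpow 2) + lscale (- 2 * z) (tpow 1)"

lemma lookup_lscale_tpow:
  "Poly_Mapping.lookup (lscale c (tpow n)) k = (if k = n then c else 0)"
  by (simp add: lscale_tpow lookup_single when_def)

lemma lookup_quad:
  "Poly_Mapping.lookup (quad x y z) k =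
    (if k = 0 then x else if k = 1 then - 2 * z else if k = 2 then - y else 0)"
  by (simp add: quad_def lookup_add lookup_minus lookup_lscale_tpow)

lemma quad_add: "quad x y z + quad x' y' z' = quad (x + x') (y + y') (z + z')"
  by (rule poly_mapping_eqI) (simp add: lookup_add lookup_quad)

lemma quad_uminus: "- quad x y z = quad (- x) (- y) (- z)"
  by (rule poly_mapping_eqI) (simp add: lookup_quad)

lemma lscale_quad: "lscale c (quad x y z) = quad (c * x) (c * y) (c * z)"
  by (simp add: quad_def laurent.scale_right_distrib laurent.scale_right_diff_distrib mult.left_commute)

lemma quad_0: "quad 0 0 0 = 0"
  by (rule poly_mapping_eqI) (simp add: lookup_quad)

lemma quad_basis: "quad 1 0 0 = 1" "quad 0 1 0 = - (tvar ^ 2)" "quad 0 0 1 = - 2 * tvar"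
proof -
  show "quad 1 0 0 = 1"
    by (simp add: quad_def tpow_0)
  have "tvar ^ 2 = tpow 2"
    by (simp add: power2_eq_square flip: tpow_add)
  then show "quad 0 1 0 = - (tvar ^ 2)"
    by (simp add: quad_def)
  \<comment> \<open>The 2 in \<open>h\<close> is a numeral of the Laurent ring and has to be matched
    with the scalar 2.\<close>
  have "lscale 2 tvar = 2 * tvar"
    using laurent.scale_left_distrib[of 1 1 tvar] by (simp only: mult_2 one_add_one laurent.scale_one)
  then show "quad 0 0 1 = - 2 * tvar"
    by (simp add: quad_def)
qed

text \<open>Each half of the bracket is such a product, since \<open>D\<close> lowers the degree by
  one. A single half may leave the span through \<open>tpow 3\<close>, so that term is kept for the
  later cancellation.\<close>

lemma quad_mult_linear:
  "quad x y z * (lscale u 1 + lscale v tvar) =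
    lscale (x * u) (tpow 0) + lscale (x * v - 2 * z * u) (tpow 1) +
    lscale (- y * u - 2 * z * v) (tpow 2) + lscale (- y * v) (tpow 3)"
proof -
  have "quad x y z * (lscale u 1 + lscale v tvar) =
      (lscale x (tpow 0) + lscale (- y) (tpow 2) + lscale (- 2 * z) (tpow 1)) *
      (lscale u (tpow 0) + lscale v (tpow 1))"
    by (simp add: quad_def tpow_0)
  also have "\<dots> = lscale (x * u) (tpow 0) + lscale (x * v - 2 * z * u) (tpow 1) +
      lscale (- y * u - 2 * z * v) (tpow 2) + lscale (- y * v) (tpow 3)"
    by (rule poly_mapping_eqI)
      (simp add: distrib_left distrib_right lookup_add lscale_tpow mult_single lookup_single when_def)
  finally show ?thesis .
qed

lemma laurent_endomorphism_quad:
  assumes "laurent_endomorphism \<phi>" "\<phi> tvar = lscale p tvar" "p \<noteq> 0"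
  shows "\<phi> (quad x y z) = quad x (p\<^sup>2 * y) (p * z)"
proof -
  interpret Vector_Spaces.linear lscale lscale \<phi>
    using assms(1) by (simp add: laurent_endomorphism_def)
  show ?thesis
    by (simp only: quad_def add scale laurent_endomorphism_tpow[OF assms])
      (simp add: mult_ac)
qed

text \<open>The endomorphism sending t to t / p is a left inverse, as seen on monomials. Injectivity
  makes \<open>inv \<tau>\<close> a genuine left inverse, so that its values can be read off from
  preimages.\<close>

lemma inj_laurent_endomorphism:
  assumes "laurent_endomorphism \<phi>" "\<phi> tvar = lscale p tvar" "p \<noteq> 0"
  shows "inj \<phi>"
proof -
  obtain \<psi> where \<psi>: "laurent_endomorphism \<psi>" "\<psi> tvar = lscale (inverse p) tvar"
    using laurent_endomorphism_exists[of "inverse p"] assms(3) by auto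
  interpret \<phi>: Vector_Spaces.linear lscale lscale \<phi>
    using assms(1) by (simp add: laurent_endomorphism_def)
  interpret \<psi>: Vector_Spaces.linear lscale lscale \<psi>
    using \<psi>(1) by (simp add: laurent_endomorphism_def)
  have "inverse p \<noteq> 0" using assms(3) by simp
  note tpow = laurent_endomorphism_tpow[OF assms] laurent_endomorphism_tpow[OF \<psi> this]
  have "\<psi> (\<phi> a) = a" for a
    by (induction a rule: laurent_induct)
      (simp_all add: \<phi>.zero \<psi>.zero \<phi>.add \<psi>.add \<phi>.scale \<psi>.scale tpow assms(3) power_int_inverse)
  then show ?thesis by (rule inj_on_inverseI)
qed

lemma inv_laurent_endomorphism_quad:
  assumes "laurent_endomorphism \<phi>" "\<phi> tvar = lscale p tvar" "p \<noteq> 0"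
  shows "inv \<phi> (quad x y z) = quad x (y / p\<^sup>2) (z / p)"
  using laurent_endomorphism_quad[OF assms, of x "y / p\<^sup>2" "z / p"] assms(3)
  by (intro inv_f_eq inj_laurent_endomorphism[OF assms]) simp

text \<open>On monomials, 1 goes to 0, t to 1 and t^2 to (p + q) t, the last because p - q divides
  p^2 - q^2.\<close>

lemma pq_derivation_quad:
  assumes "laurent_endomorphism \<tau>" "\<tau> tvar = lscale p tvar" "p \<noteq> 0"
    and "laurent_endomorphism \<sigma>" "\<sigma> tvar = lscale q tvar" "q \<noteq> 0" "p \<noteq> q"
  shows "pq_derivation p q \<tau> \<sigma> (quad x y z) = lscale (- 2 * z) 1 + lscale (- (p + q) * y) tvar"
proof -
  interpret Vector_Spaces.linear lscale lscale "pq_derivation p q \<tau> \<sigma>"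
    using twisted_derivation_pq_derivation[OF assms(1,4)] by (simp add: twisted_derivation_def)
  have "(p\<^sup>2 - q\<^sup>2) / (p - q) = p + q"
    using assms(7) by (simp add: power2_eq_square square_diff_square_factored)
  then have "- y * ((p\<^sup>2 - q\<^sup>2) / (p - q)) = - (p + q) * y"
    by (simp only:) (rule minus_mult_commute[THEN trans], rule mult.commute)
  moreover have "- 2 * z * ((p - q) / (p - q)) = - 2 * z"
    using assms(7) by simp
  ultimately show ?thesis
    unfolding quad_def add scale pq_derivation_tpow[OF assms(1-6)]
    by (simp add: tpow_0 del: laurent.scale_minus_left mult_minus_left)
qed

lemma pq_bracket_quad:
  assumes "laurent_endomorphism \<tau>" "\<tau> tvar = lscale p tvar" "p \<noteq> 0"
    and "laurent_endomorphism \<sigma>" "\<sigma> tvar = lscale q tvar" "q \<noteq> 0" "p \<noteq> q"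
    and "D = pq_derivation p q \<tau> \<sigma>"
  shows "\<sigma> (inv \<tau> (quad x y z)) * D (inv \<tau> (quad x' y' z')) -
      \<sigma> (inv \<tau> (quad x' y' z')) * D (inv \<tau> (quad x y z)) =
    quad (2 / p * (z * x' - x * z')) (- 2 * q / p\<^sup>2 * (z * y' - y * z'))
      ((p + q) / (2 * p\<^sup>2) * (x * y' - y * x'))"
proof -
  \<comment> \<open>With 1 / p as a variable, the coefficient comparisons become polynomial
    identities.\<close>
  define u where "u = inverse p"
  have pu: "p * u = 1" using assms(3) by (simp add: u_def)
  have div: "c / p = c * u" "c / p\<^sup>2 = c * u\<^sup>2" "c / (2 * p\<^sup>2) = c / 2 * u\<^sup>2" for c
    using assms(3) by (simp_all add: u_def field_simps)
  \<comment> \<open>Coefficients of t^0 to t^3. In the second the z z' terms cancel; the third is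
    the only one that uses \<open>p * u = 1\<close>; the fourth vanishes by symmetry in y and y',
    which keeps the bracket inside the span.\<close>
  have coeffs:
    "x * (- 2 * (z' * u)) - x' * (- 2 * (z * u)) = 2 * u * (z * x' - x * z')"
    "x * (- (p + q) * (y' * u\<^sup>2)) - 2 * (q * (z * u)) * (- 2 * (z' * u)) -
      (x' * (- (p + q) * (y * u\<^sup>2)) - 2 * (q * (z' * u)) * (- 2 * (z * u))) =
      - 2 * ((p + q) / 2 * u\<^sup>2 * (x * y' - y * x'))"
    "- (q\<^sup>2 * (y * u\<^sup>2)) * (- 2 * (z' * u)) - 2 * (q * (z * u)) * (- (p + q) * (y' * u\<^sup>2)) -
      (- (q\<^sup>2 * (y' * u\<^sup>2)) * (- 2 * (z * u)) - 2 * (q * (z' * u)) * (- (p + q) * (y * u\<^sup>2))) =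
      - (- 2 * q * u\<^sup>2 * (z * y' - y * z'))"
    "- (q\<^sup>2 * (y * u\<^sup>2)) * (- (p + q) * (y' * u\<^sup>2)) -
      - (q\<^sup>2 * (y' * u\<^sup>2)) * (- (p + q) * (y * u\<^sup>2)) = 0"
  proof goal_cases
    case 2
    \<comment> \<open>Clears the division by 2, leaving a pure ring identity for
      \<open>algebra\<close>.\<close>
    have half: "- 2 * ((p + q) / 2 * u\<^sup>2 * (x * y' - y * x')) = - ((p + q) * u\<^sup>2 * (x * y' - y * x'))"
      by simp
    show ?case unfolding half by algebra
  next
    case 3
    show ?case using pu by algebra
  qed algebra+
  have diff: "lscale a (tpow 0) + lscale b (tpow 1) + lscale c (tpow 2) + lscale d (tpow 3) -
      (lscale a' (tpow 0) + lscale b' (tpow 1) + lscale c' (tpow 2) + lscale d' (tpow 3)) =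
      lscale (a - a') (tpow 0) + lscale (b - b') (tpow 1) + lscale (c - c') (tpow 2) +
      lscale (d - d') (tpow 3)" for a b c d a' b' c' d'
    by (simp add: laurent.scale_left_diff_distrib)
  show ?thesis
    unfolding assms(8) inv_laurent_endomorphism_quad[OF assms(1-3)]
      laurent_endomorphism_quad[OF assms(4-6)] pq_derivation_quad[OF assms(1-7)] quad_mult_linear
      div diff coeffs
    unfolding quad_def
    by simp
qed

lemma lmult_add: "(a + b) \<cdot> D = a \<cdot> D + b \<cdot> D"
  by (simp add: lmult_def fun_eq_iff distrib_right)

lemma lmult_uminus: "(- a) \<cdot> D = - (a \<cdot> D)"
  by (simp add: lmult_def fun_eq_iff)

lemma mscale_lmult: "mscale c (a \<cdot> D) = lscale c a \<cdot> D"
  by (simp add: lmult_def mscale_def fun_eq_iff lscale_mult_left)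

text \<open>Quantifiers over the span can thus be traded for quantifiers over three scalars.\<close>

lemma span_quad_basis:
  "laurent_maps.span {quad 1 0 0 \<cdot> D, quad 0 1 0 \<cdot> D, quad 0 0 1 \<cdot> D} =
    {quad x y z \<cdot> D | x y z. True}" (is "laurent_maps.span ?B = ?R")
proof
  have "laurent_maps.subspace ?R"
  proof (rule laurent_maps.subspaceI)
    have "0 = quad 0 0 0 \<cdot> D" by (simp add: quad_0 lmult_def fun_eq_iff)
    then show "0 \<in> ?R" by blast
  next
    fix X Y assume "X \<in> ?R" "Y \<in> ?R"
    then obtain x y z x' y' z' where "X = quad x y z \<cdot> D" "Y = quad x' y' z' \<cdot> D" by blast
    then have "X + Y = quad (x + x') (y + y') (z + z') \<cdot> D"
      by (simp add: quad_add flip: lmult_add)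
    then show "X + Y \<in> ?R" by blast
  next
    fix c X assume "X \<in> ?R"
    then obtain x y z where "X = quad x y z \<cdot> D" by blast
    then have "mscale c X = quad (c * x) (c * y) (c * z) \<cdot> D"
      by (simp add: mscale_lmult lscale_quad)
    then show "mscale c X \<in> ?R" by blast
  qed
  then show "laurent_maps.span ?B \<subseteq> ?R"
    by (intro laurent_maps.span_minimal) auto
next
  show "?R \<subseteq> laurent_maps.span ?B"
  proof
    fix X assume "X \<in> ?R"
    then obtain x y z where "X = quad x y z \<cdot> D" by blast
    then have "X = mscale x (quad 1 0 0 \<cdot> D) + mscale y (quad 0 1 0 \<cdot> D) + mscale z (quad 0 0 1 \<cdot> D)"
      by (simp add: mscale_lmult lscale_quad quad_add flip: lmult_add)
    then show "X \<in> laurent_maps.span ?B"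
      by (simp add: laurent_maps.span_add laurent_maps.span_scale laurent_maps.span_base)
  qed
qed

theorem theorem3p7:
  fixes p q :: complex
    and \<tau> \<sigma> D e f h :: "laurent \<Rightarrow> laurent"
    and br :: "(laurent \<Rightarrow> laurent) \<Rightarrow> (laurent \<Rightarrow> laurent) \<Rightarrow> (laurent \<Rightarrow> laurent)"
    and S :: "(laurent \<Rightarrow> laurent) set"
  assumes "p \<noteq> 0" and "q \<noteq> 0" and "p \<noteq> q"
    and "laurent_endomorphism \<tau>" and "\<tau> tvar = lscale p tvar"
    and "laurent_endomorphism \<sigma>" and "\<sigma> tvar = lscale q tvar"
    and "D = pq_derivation p q \<tau> \<sigma>"
    and "\<And>a b. br (a \<cdot> D) (b \<cdot> D) =
      (\<sigma> (inv \<tau> a) * D (inv \<tau> b) - \<sigma> (inv \<tau> b) * D (inv \<tau> a)) \<cdot> D"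
    and "e = D" and "f = (- (tvar ^ 2)) \<cdot> D" and "h = (- 2 * tvar) \<cdot> D"
    and "S = laurent_maps.span {e, f, h}"
  shows "S \<subseteq> range (\<lambda>a. a \<cdot> D) \<and>
    br h e = mscale (2 * inverse p) e \<and>
    br h f = mscale (- 2 * q * inverse (p ^ 2)) f \<and>
    br e f = mscale ((p + q) / (2 * p ^ 2)) h \<and>
    (\<exists>\<alpha>. hom_lie_algebra mscale S br \<alpha> \<and>
      \<alpha> e = mscale (1 + q * inverse p) e \<and>
      \<alpha> f = mscale (q * inverse p * (1 + q * inverse p)) f \<and>
      \<alpha> h = mscale (2 * q * inverse p) h)"
proof -
  \<comment> \<open>In \<open>r\<close> and \<open>v\<close> all structure constants (4v, -4rv, (1 +
    r)v) and all eigenvalues of the twist (1 + r, r(1 + r), 2r) are polynomials, so the axioms can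
    be checked without division.\<close>
  define r where "r = q / p"
  define v where "v = 1 / (2 * p)"
  \<comment> \<open>The entries \<open>c 0\<close>, \<open>- c 2\<close> and
    \<open>- c 1 / 2\<close> undo the normalisation in \<open>quad\<close>, returning x, y and
    z.\<close>
  define \<alpha> where "\<alpha> X = (let c = Poly_Mapping.lookup (X tvar) in
    quad ((1 + r) * c 0) (r * (1 + r) * - c 2) (2 * r * (- c 1 / 2)) \<cdot> D)" for X :: "laurent \<Rightarrow> laurent"
  have "D (quad 0 0 (- 1 / 2)) = lscale 1 1"
    unfolding assms(8) pq_derivation_quad[OF assms(4,5,1,6,7,2,3)] by simp
  moreover have "quad 0 0 (- 1 / 2) = tvar" by (simp add: quad_def)
  ultimately have D_tvar: "D tvar = 1" by simp
  have \<alpha>: "\<alpha> (quad x y z \<cdot> D) = quad ((1 + r) * x) (r * (1 + r) * y) (2 * r * z) \<cdot> D" for x y z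
    by (simp add: \<alpha>_def lmult_def D_tvar lookup_quad mult_ac)
  have br: "br (quad x y z \<cdot> D) (quad x' y' z' \<cdot> D) =
      quad (4 * v * (z * x' - x * z')) (- 4 * r * v * (z * y' - y * z'))
        ((1 + r) * v * (x * y' - y * x')) \<cdot> D" for x y z x' y' z'
  proof -
    have "2 / p = 4 * v" "- 2 * q / p\<^sup>2 = - 4 * r * v" "(p + q) / (2 * p\<^sup>2) = (1 + r) * v"
      using assms(1) by (simp_all add: r_def v_def field_simps power2_eq_square)
    then show ?thesis
      unfolding assms(9) pq_bracket_quad[OF assms(4,5,1,6,7,2,3,8)] by simp
  qed
  have e: "e = quad 1 0 0 \<cdot> D" and f: "f = quad 0 1 0 \<cdot> D" and h: "h = quad 0 0 1 \<cdot> D"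
    unfolding assms(10-12) quad_basis by (simp_all add: lmult_def)
  have S: "S = {quad x y z \<cdot> D | x y z. True}"
    unfolding assms(13) e f h by (rule span_quad_basis)
  have add: "quad x y z \<cdot> D + quad x' y' z' \<cdot> D = quad (x + x') (y + y') (z + z') \<cdot> D"
    for x y z x' y' z' by (simp add: quad_add flip: lmult_add)
  have scale: "mscale c (quad x y z \<cdot> D) = quad (c * x) (c * y) (c * z) \<cdot> D" for c x y z
    by (simp add: mscale_lmult lscale_quad)
  have zero: "quad 0 0 0 \<cdot> D = 0"
    by (simp add: quad_0 lmult_def fun_eq_iff)
  have uminus: "- (quad x y z \<cdot> D) = quad (- x) (- y) (- z) \<cdot> D" for x y z
    by (simp add: quad_uminus flip: lmult_uminus)
  \<comment> \<open>Splits a vector identity into three scalar ones.\<close>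
  have eqI: "quad x y z \<cdot> D = quad x' y' z' \<cdot> D" if "x = x'" "y = y'" "z = z'" for x y z x' y' z'
    using that by simp
  have eq0I: "quad x y z \<cdot> D = 0" if "x = 0" "y = 0" "z = 0" for x y z
    using that zero by simp
  have S_I: "quad x y z \<cdot> D \<in> S" for x y z using S by blast
  have S_all: "(\<forall>X\<in>S. P X) \<longleftrightarrow> (\<forall>x y z. P (quad x y z \<cdot> D))" for P using S by blast
  have "laurent_maps.subspace S" using assms(13) by simp
  moreover have "vector_space mscale" by (fact laurent_maps.vector_space_axioms)
  \<comment> \<open>In coordinates closure is immediate from \<open>S_I\<close>, and every identity,
    Hom-Jacobi included, becomes three polynomial identities that hold by expansion.\<close>
  ultimately have hom_lie: "hom_lie_algebra mscale S br \<alpha>"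
    unfolding hom_lie_algebra_def S_all add scale br \<alpha> uminus
    by (intro conjI allI S_I eqI eq0I) (assumption | simp add: algebra_simps)+
  have "S \<subseteq> range (\<lambda>a. a \<cdot> D)" using S by blast
  moreover have "br h e = mscale (2 * inverse p) e"
    "br h f = mscale (- 2 * q * inverse (p ^ 2)) f"
    "br e f = mscale ((p + q) / (2 * p ^ 2)) h"
    unfolding e f h br scale using assms(1) by (simp_all add: r_def v_def field_simps power2_eq_square)
  moreover have "\<alpha> e = mscale (1 + q * inverse p) e"
    "\<alpha> f = mscale (q * inverse p * (1 + q * inverse p)) f"
    "\<alpha> h = mscale (2 * q * inverse p) h"
    unfolding e f h \<alpha> scale by (simp_all add: r_def divide_inverse mult.assoc)
  ultimately show ?thesis using hom_lie by blast
qed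

end
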